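(* Let $m\ge2$ be even, $n\ge2$, and let $\mathcal{A}^I=[\underline{\mathcal{A}},\overline{\mathcal{A}}]$ be a symmetric interval tensor in $T_{m,n}$ with $R_i(\underline{\mathcal{A}})>0$ for all $i\in[n]$. If $$\overline{S}:=\sum_{i=1}^n\Bigl[\max_{\{J\in[n]^{m-1}:\,i\in J\}}\overline{M}_J\Bigr]_+^{\frac{1}{m-1}}<1,$$ then $\mathcal{A}^I$ is a positive definite interval tensor.
   Context: $[n]=\{1,\dots,n\}$. $T_{m,n}$ is the set of real $m$th-order $n$-dimensional tensors. For $J=(i_2,\dots,i_m)\in[n]^{m-1}$ write $a_{iJ}=a_{ii_2\cdots i_m}$; $i\in J$ means that $i$ is one of the components of $J$. The $i$th row sum is $R_i(\mathcal{A})=\sum_{J\in[n]^{m-1}}a_{iJ}$. $[a]_+=\max\{0,a\}$. For $\underline{\mathcal{A}}\le\overline{\mathcal{A}}$ (componentwise) in $T_{m,n}$, the interval tensor is $\mathcal{A}^I=[\underline{\mathcal{A}},\overline{\mathcal{A}}]=\{\mathcal{A}:\underline{\mathcal{A}}\le\mathcal{A}\le\overline{\mathcal{A}}\}$. It is symmetric if both its center $(\underline{\mathcal{A}}+\overline{\mathcal{A}})/2$ and its radius $(\overline{\mathcal{A}}-\underline{\mathcal{A}})/2$ are symmetric tensors (entries invariant under all permutations of the indices); tensors in a symmetric $\mathcal{A}^I$ need not be symmetric. For $J\in[n]^{m-1}$ define $$\overline{M}_{iJ}=\max\Bigl\{\frac{\overline{a}_{iJ}}{\overline{a}_{iJ}+\sum_{K\in[n]^{m-1},\,K\ne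 J}\underline{a}_{iK}},\ \frac{\overline{a}_{iJ}}{R_i(\overline{\mathcal{A}})}\Bigr\},\qquad \overline{M}_J=\max_{i\in[n],\ (i,\dots,i)\ne J}\overline{M}_{iJ}.$$ A tensor $\mathcal{A}\in T_{m,n}$ is positive definite if $\sum_{i_1,\dots,i_m=1}^na_{i_1\cdots i_m}x_{i_1}\cdots x_{i_m}>0$ for all nonzero $x\in\mathbb{R}^n$; $\mathcal{A}^I$ is a positive definite interval tensor if every $\mathcal{A}\in\mathcal{A}^I$ is positive definite. *)

theory Defs
  imports "HOL-Analysis.Analysis"
begin

text \<open>
  The index set \<open>{1,\<dots>,n}\<close> is a finite type \<open>'n\<close> with \<open>CARD('n) = n\<close>, and an \<open>m\<close>-th order tensor
  is a function of the multi-indices \<open>[i\<^sub>1, \<dots>, i\<^sub>m]\<close>, given as lists of length \<open>m\<close>. The order is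
  an explicit parameter of the notions below; values at lists of any other length are junk and are
  never inspected. The entry \<open>a\<^bsub>iJ\<^esub>\<close> is \<open>A (i # J)\<close>.
\<close>

type_synonym 'n tensor = "'n list \<Rightarrow> real"

definition multi_indices :: "nat \<Rightarrow> 'n list set" where
  "multi_indices k = {I. length I = k}"

definition tensor_le :: "nat \<Rightarrow> 'n tensor \<Rightarrow> 'n tensor \<Rightarrow> bool" where
  "tensor_le m A B \<longleftrightarrow> (\<forall>I\<in>multi_indices m. A I \<le> B I)"

definition interval_tensor :: "nat \<Rightarrow> 'n tensor \<Rightarrow> 'n tensor \<Rightarrow> 'n tensor set" where
  "interval_tensor m L U = {A. tensor_le m L A \<and> tensor_le m A U}"

definition symmetric_tensor :: "nat \<Rightarrow> 'n tensor \<Rightarrow> bool" where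
  "symmetric_tensor m A \<longleftrightarrow>
     (\<forall>I\<in>multi_indices m. \<forall>\<sigma>. \<sigma> permutes {..<m} \<longrightarrow> A (permute_list \<sigma> I) = A I)"

definition tensor_center :: "'n tensor \<Rightarrow> 'n tensor \<Rightarrow> 'n tensor" where
  "tensor_center L U = (\<lambda>I. (L I + U I) / 2)"

definition tensor_radius :: "'n tensor \<Rightarrow> 'n tensor \<Rightarrow> 'n tensor" where
  "tensor_radius L U = (\<lambda>I. (U I - L I) / 2)"

text \<open>Individual members of a symmetric interval tensor need not be symmetric.\<close>

definition symmetric_interval_tensor :: "nat \<Rightarrow> 'n tensor \<Rightarrow> 'n tensor \<Rightarrow> bool" where
  "symmetric_interval_tensor m L U \<longleftrightarrow>
     symmetric_tensor m (tensor_center L U) \<and> symmetric_tensor m (tensor_radius L U)"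

definition tensor_row_sum :: "nat \<Rightarrow> 'n tensor \<Rightarrow> 'n \<Rightarrow> real" where
  "tensor_row_sum m A i = (\<Sum>J\<in>multi_indices (m - 1). A (i # J))"

definition Mbar_entry :: "nat \<Rightarrow> 'n tensor \<Rightarrow> 'n tensor \<Rightarrow> 'n \<Rightarrow> 'n list \<Rightarrow> real" where
  "Mbar_entry m L U i J =
     max (U (i # J) / (U (i # J) + (\<Sum>K\<in>multi_indices (m - 1) - {J}. L (i # K))))
         (U (i # J) / tensor_row_sum m U i)"

definition Mbar :: "nat \<Rightarrow> 'n tensor \<Rightarrow> 'n tensor \<Rightarrow> 'n list \<Rightarrow> real" where
  "Mbar m L U J = Max {Mbar_entry m L U i J | i. replicate (m - 1) i \<noteq> J}"

text \<open>
  The \<open>powr\<close> is applied to a nonnegative number, and \<open>0 powr a = 0\<close> is the correct value of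
  \<open>0\<close> raised to the positive power \<open>1 / (m - 1)\<close>.
\<close>

definition Sbar :: "nat \<Rightarrow> 'n::finite tensor \<Rightarrow> 'n tensor \<Rightarrow> real" where
  "Sbar m L U =
     (\<Sum>i\<in>UNIV. max 0 (Max {Mbar m L U J | J. J \<in> multi_indices (m - 1) \<and> i \<in> set J})
                  powr (1 / (real m - 1)))"

definition tensor_form :: "nat \<Rightarrow> 'n::finite tensor \<Rightarrow> real ^ 'n \<Rightarrow> real" where
  "tensor_form m A x = (\<Sum>I\<in>multi_indices m. A I * prod_list (map (\<lambda>i. x $ i) I))"

definition positive_definite_tensor :: "nat \<Rightarrow> 'n::finite tensor \<Rightarrow> bool" where
  "positive_definite_tensor m A \<longleftrightarrow> (\<forall>x. x \<noteq> 0 \<longrightarrow> tensor_form m A x > 0)"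

definition positive_definite_interval_tensor ::
  "nat \<Rightarrow> 'n::finite tensor \<Rightarrow> 'n tensor \<Rightarrow> bool" where
  "positive_definite_interval_tensor m L U \<longleftrightarrow>
     (\<forall>A\<in>interval_tensor m L U. positive_definite_tensor m A)"

end

theory Submission
  imports Defs
begin

text \<open>
  Fix a nonzero \<open>x\<close>. Among all members of the interval the form at \<open>x\<close> is smallest at the tensor
  \<open>A\<close> whose entry at \<open>I\<close> is \<open>L I\<close> or \<open>U I\<close> according to the sign of the monomial \<open>x\<^sub>I\<close>. As \<open>x\<^sub>I\<close> is
  invariant under permutations of \<open>I\<close>, this \<open>A\<close> is symmetric, so it suffices to treat one symmetric
  tensor. With \<open>s\<^sub>i\<close> the \<open>i\<close>-th summand of \<open>Sbar m L U\<close>, slightly enlarged so that it is positive,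
  the hypothesis turns into \<open>a\<^bsub>iJ\<^esub> \<le> R\<^sub>i(A) * (\<Prod>j\<in>J. s\<^sub>j)\<close> for \<open>J \<noteq> (i,\<dots>,i)\<close>, with \<open>(\<Sum>i. s\<^sub>i) < 1\<close>
  (lemmas \<open>entry_le_row_sum_Mbar\<close> and \<open>Mbar_le_prod_summands\<close>).

  Put \<open>q\<^sub>i = R\<^sub>i(A) / s\<^sub>i\<close>. Since \<open>A\<close> is symmetric, any component of a multi-index \<open>I\<close> may be moved to
  the front, whence \<open>a\<^sub>I \<le> b\<^sub>I\<close> for every nonconstant \<open>I\<close>, where
  \<open>b\<^sub>I = (min\<^bsub>k\<in>I\<^esub> q\<^sub>k) * (\<Prod>k\<in>I. s\<^sub>k)\<close>. Two facts finish the proof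
  (lemma \<open>pos_def_if_entries_le_row_sum_prod\<close>):

  \<^item> The tensor \<open>B\<close> is positive semidefinite: writing the minimum as an integral of indicators over the
    levels \<open>t\<close> below it gives \<open>B x\<^sup>m = \<integral> (\<Sum>j | t \<le> q\<^sub>j. s\<^sub>j x\<^sub>j)\<^sup>m dt\<close>, and \<open>m\<close> is even
    (lemma \<open>min_tensor_psd\<close>).
  \<^item> The symmetric tensor \<open>A - B\<close> has nonpositive off-diagonal entries, and its \<open>i\<close>-th row sum is at
    least \<open>R\<^sub>i(A) * (1 - (\<Sum>j. s\<^sub>j)^(m-1)) > 0\<close>. Bounding each off-diagonal monomial by the mean of
    the \<open>m\<close>-th powers of its factors shows that such a tensor is positive definite
    (lemma \<open>Z_tensor_pos_def\<close>).
\<close>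

section \<open>Sums over multi-indices\<close>

lemma multi_indices_0 [simp]: "multi_indices 0 = {[]}"
  by (auto simp: multi_indices_def)

lemma finite_multi_indices [simp]: "finite (multi_indices k :: 'n::finite list set)"
  using finite_lists_length_eq[of "UNIV :: 'n set" k] by (simp add: multi_indices_def)

lemma sum_multi_indices_Suc:
  fixes f :: "'n::finite list \<Rightarrow> real"
  shows "(\<Sum>I\<in>multi_indices (Suc k). f I) = (\<Sum>i\<in>UNIV. \<Sum>J\<in>multi_indices k. f (i # J))"
proof -
  have "(\<Sum>I\<in>multi_indices (Suc k). f I)
      = (\<Sum>(i, J)\<in>UNIV \<times> multi_indices k. f (i # J))"
    by (rule sum.reindex_bij_witness[of _ "\<lambda>(i, J). i # J" "\<lambda>I. (hd I, tl I)"])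
       (auto simp: multi_indices_def length_Suc_conv)
  then show ?thesis
    by (simp add: sum.cartesian_product)
qed

lemma sum_multi_indices_prod_list:
  fixes f :: "'n::finite \<Rightarrow> real"
  shows "(\<Sum>I\<in>multi_indices k. prod_list (map f I)) = (\<Sum>i\<in>UNIV. f i) ^ k"
proof (induction k)
  case (Suc k)
  have "(\<Sum>I\<in>multi_indices (Suc k). prod_list (map f I))
      = (\<Sum>i\<in>UNIV. f i * (\<Sum>J\<in>multi_indices k. prod_list (map f J)))"
    by (simp add: sum_multi_indices_Suc sum_distrib_left)
  also have "\<dots> = (\<Sum>i\<in>UNIV. f i) ^ Suc k"
    by (simp add: Suc.IH sum_distrib_right)
  finally show ?case .
qed simp

lemma prod_list_map_conv_nth:
  "prod_list (map f I) = (\<Prod>k<length I. f (I ! k) :: real)"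
  by (subst prod.list_conv_set_nth) (simp add: atLeast0LessThan)

section \<open>Symmetric tensors\<close>

text \<open>Symmetry in the form used below: an entry depends only on the multiset of its indices.\<close>

lemma symmetric_tensor_iff_mset:
  "symmetric_tensor m A \<longleftrightarrow>
     (\<forall>I\<in>multi_indices m. \<forall>J\<in>multi_indices m. mset I = mset J \<longrightarrow> A I = A J)"
proof
  assume A: "symmetric_tensor m A"
  show "\<forall>I\<in>multi_indices m. \<forall>J\<in>multi_indices m. mset I = mset J \<longrightarrow> A I = A J"
  proof (intro ballI impI)
    fix I J :: "'a list"
    assume J: "J \<in> multi_indices m" and "mset I = mset J"
    then obtain p where "p permutes {..<length J}" "permute_list p J = I"
      using mset_eq_permutation by blast
    then show "A I = A J"
      using A J by (auto simp: symmetric_tensor_def multi_indices_def)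
  qed
next
  assume *: "\<forall>I\<in>multi_indices m. \<forall>J\<in>multi_indices m. mset I = mset J \<longrightarrow> A I = A J"
  show "symmetric_tensor m A"
    unfolding symmetric_tensor_def
  proof (intro ballI allI impI)
    fix I :: "'a list" and p
    assume "I \<in> multi_indices m" and "p permutes {..<m}"
    then have "permute_list p I \<in> multi_indices m" "mset (permute_list p I) = mset I"
      by (simp_all add: multi_indices_def)
    with * \<open>I \<in> multi_indices m\<close> show "A (permute_list p I) = A I"
      by blast
  qed
qed

lemma symmetric_tensorD:
  assumes "symmetric_tensor m A" "length I = m" "mset I = mset J"
  shows "A I = A J"
proof -
  have "I \<in> multi_indices m" "J \<in> multi_indices m"
    using assms(2) mset_eq_length[OF assms(3)] by (simp_all add: multi_indices_def)
  then show ?thesis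
    using assms unfolding symmetric_tensor_iff_mset by blast
qed

lemma prod_list_map_mset_cong:
  assumes "mset I = mset J"
  shows "prod_list (map f I) = (prod_list (map f J) :: real)"
proof -
  have "mset (map f I) = mset (map f J)"
    using assms by simp
  then show ?thesis
    by (metis prod_mset_prod_list)
qed

lemma symmetric_interval_tensorD:
  assumes "symmetric_interval_tensor m L U"
  shows "symmetric_tensor m L" and "symmetric_tensor m U"
proof -
  have *: "L I = L J \<and> U I = U J"
    if "I \<in> multi_indices m" "J \<in> multi_indices m" "mset I = mset J" for I J
  proof -
    have "(L I + U I) / 2 = (L J + U J) / 2" "(U I - L I) / 2 = (U J - L J) / 2"
      using assms that
      unfolding symmetric_interval_tensor_def symmetric_tensor_iff_mset
        tensor_center_def tensor_radius_def by blast+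
    then show ?thesis by (simp add: field_simps)
  qed
  show "symmetric_tensor m L" "symmetric_tensor m U"
    unfolding symmetric_tensor_iff_mset using * by blast+
qed

text \<open>A weight read off at any one position of the multi-index may be read off at the first.\<close>

lemma symmetric_tensor_sum_nth:
  fixes A :: "'n::finite tensor" and g :: "'n \<Rightarrow> real"
  assumes sym: "symmetric_tensor m A" and k: "k < m"
  shows "(\<Sum>I\<in>multi_indices m. A I * g (I ! k)) = (\<Sum>i\<in>UNIV. tensor_row_sum m A i * g i)"
proof -
  define h :: "'n list \<Rightarrow> 'n list" where "h I = I[0 := I ! k, k := I ! 0]" for I
  have len: "length (h I) = length I" for I
    by (simp add: h_def)
  have ms: "mset (h I) = mset I" if "length I = m" for I
    unfolding h_def using that k by (intro mset_swap) auto
  have inv: "h (h I) = I" if "length I = m" for I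
    by (rule nth_equalityI) (use that k in \<open>auto simp: h_def nth_list_update\<close>)
  have h0: "h I ! 0 = I ! k" if "length I = m" for I
    using that k by (cases "k = 0") (simp_all add: h_def)
  obtain m' where m': "m = Suc m'"
    using k by (cases m) auto
  have "(\<Sum>I\<in>multi_indices m. A I * g (I ! k)) = (\<Sum>I\<in>multi_indices m. A I * g (I ! 0))"
    by (rule sum.reindex_bij_witness[of _ h h])
       (simp_all add: multi_indices_def len inv h0 symmetric_tensorD[OF sym _ ms])
  also have "\<dots> = (\<Sum>i\<in>UNIV. tensor_row_sum m A i * g i)"
    by (simp add: m' sum_multi_indices_Suc tensor_row_sum_def sum_distrib_right)
  finally show ?thesis .
qed

section \<open>Symmetric tensors with nonpositive off-diagonal entries\<close>

lemma even_prod_list_le_mean_power: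
  fixes y :: "'n \<Rightarrow> real"
  assumes "even (length I)" and "I \<noteq> []"
  shows "prod_list (map y I) \<le> (\<Sum>k<length I. y (I ! k) ^ length I) / length I"
proof -
  let ?m = "length I"
  have m: "?m > 0" using assms by simp
  let ?P = "\<Prod>k<?m. \<bar>y (I ! k)\<bar>"
  have P: "?P \<ge> 0" by (simp add: prod_nonneg)
  have "prod_list (map y I) \<le> ?P"
    by (simp add: prod_list_map_conv_nth flip: abs_prod)
  also have "?P = (?P ^ ?m) powr (1 / ?m)"
    using m P by (simp add: powr_powr flip: powr_realpow')
  also have "\<dots> = (\<Prod>k<?m. y (I ! k) ^ ?m) powr (1 / ?m)"
    using assms(1) by (simp add: prod_power_distrib power_even_abs)
  also have "\<dots> \<le> (\<Sum>k<?m. y (I ! k) ^ ?m / ?m)"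
    using arith_geom_mean[of "{..<?m}" "\<lambda>k. y (I ! k) ^ ?m"] assms
    by (auto simp: zero_le_even_power)
  finally show ?thesis by (simp add: sum_divide_distrib)
qed

text \<open>
  The form of \<open>D\<close> is bounded below by \<open>(\<Sum>i. R\<^sub>i(D) * y\<^sub>i\<^sup>m)\<close>: replacing each monomial by the mean of
  the \<open>m\<close>-th powers of its factors changes nothing on the diagonal and only decreases the other
  terms, and by symmetry each of the \<open>m\<close> positions then contributes the same amount.
\<close>

lemma Z_tensor_pos_def:
  fixes D :: "'n::finite tensor" and y :: "'n \<Rightarrow> real"
  assumes sym: "symmetric_tensor m D" and m: "even m" "m > 0"
    and off: "\<And>I. length I = m \<Longrightarrow> (\<And>i. I \<noteq> replicate m i) \<Longrightarrow> D I \<le> 0"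
    and row: "\<And>i. tensor_row_sum m D i > 0"
    and y: "y j \<noteq> 0"
  shows "(\<Sum>I\<in>multi_indices m. D I * prod_list (map y I)) > 0"
proof -
  have "0 < (\<Sum>i\<in>UNIV. tensor_row_sum m D i * y i ^ m)"
  proof (rule sum_pos2[of _ j])
    show "0 < tensor_row_sum m D j * y j ^ m"
      using row[of j] y m by (simp add: zero_less_power_eq)
    show "0 \<le> tensor_row_sum m D i * y i ^ m" for i
      using row[of i] m by (simp add: zero_le_even_power)
  qed auto
  also have "\<dots> = (\<Sum>k<m. \<Sum>I\<in>multi_indices m. D I * y (I ! k) ^ m) / m"
    using m symmetric_tensor_sum_nth[OF sym, of _ "\<lambda>i. y i ^ m"] by simp
  also have "\<dots> = (\<Sum>I\<in>multi_indices m. D I * ((\<Sum>k<m. y (I ! k) ^ m) / m))"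
    by (subst sum.swap) (simp add: sum_divide_distrib sum_distrib_left)
  also have "\<dots> \<le> (\<Sum>I\<in>multi_indices m. D I * prod_list (map y I))"
  proof (rule sum_mono)
    fix I :: "'n list" assume "I \<in> multi_indices m"
    then have I: "length I = m" by (simp add: multi_indices_def)
    show "D I * ((\<Sum>k<m. y (I ! k) ^ m) / m) \<le> D I * prod_list (map y I)"
    proof (cases "\<exists>i. I = replicate m i")
      case True
      then show ?thesis using m by (auto simp: prod_list_map_conv_nth)
    next
      case False
      then have "D I \<le> 0" using off I by blast
      moreover have "prod_list (map y I) \<le> (\<Sum>k<m. y (I ! k) ^ m) / m"
        using even_prod_list_le_mean_power[of I y] I m by auto
      ultimately show ?thesis by (rule mult_left_mono_neg[rotated])
    qed
  qed
  finally show ?thesis .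
qed

section \<open>The minimum tensor\<close>

text \<open>
  The nonnegative number \<open>Min (q ` set I)\<close> is the integral over \<open>t\<close> of the indicator of
  \<open>\<forall>i\<in>set I. t \<le> q i\<close>. For fixed \<open>t\<close> this indicator is a product over the components of \<open>I\<close>, so the
  sum over \<open>I\<close> factors into an \<open>m\<close>-th power.
\<close>

lemma min_tensor_psd:
  fixes q y :: "'n::finite \<Rightarrow> real"
  assumes m: "even m" "m > 0" and q: "\<And>i. q i \<ge> 0"
  shows "(\<Sum>I\<in>multi_indices m. Min (q ` set I) * prod_list (map y I)) \<ge> 0"
proof -
  \<comment> \<open>Any common upper bound of the values of \<open>q\<close> would do for \<open>T\<close>.\<close>
  define T where "T = (\<Sum>i\<in>UNIV. q i)"
  have qT: "q i \<le> T" for i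
    unfolding T_def by (rule member_le_sum) (auto simp: q)
  define f where "f I t = (if t \<in> {0..Min (q ` set I)} then prod_list (map y I) else 0)" for I t
  have layer: "(f I has_integral Min (q ` set I) * prod_list (map y I)) {0..T}"
    if "I \<in> multi_indices m" for I
  proof -
    have "I \<noteq> []" using that m by (auto simp: multi_indices_def)
    then obtain i where i: "i \<in> set I" by (cases I) auto
    have "Min (q ` set I) \<ge> 0" using q i by (subst Min_ge_iff) auto
    moreover have "Min (q ` set I) \<le> T"
      using i by (intro order_trans[OF Min_le qT[of i]]) auto
    ultimately show ?thesis
      unfolding f_def
      using has_integral_const_real[of "prod_list (map y I)" 0 "Min (q ` set I)"]
      by (subst has_integral_restrict) auto
  qed
  have level: "(\<Sum>I\<in>multi_indices m. f I t) = (\<Sum>i\<in>UNIV. if t \<le> q i then y i else 0) ^ m"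
    if "t \<in> {0..T}" for t
    unfolding sum_multi_indices_prod_list[symmetric]
  proof (rule sum.cong)
    fix I :: "'n list" assume "I \<in> multi_indices m"
    then have ne: "I \<noteq> []" using m by (auto simp: multi_indices_def)
    have "prod_list (map (\<lambda>i. if t \<le> q i then y i else 0) I)
        = (if \<forall>i\<in>set I. t \<le> q i then prod_list (map y I) else 0)" for I
      by (induction I) auto
    then show "f I t = prod_list (map (\<lambda>i. if t \<le> q i then y i else 0) I)"
      using that ne by (auto simp: f_def Min_ge_iff)
  qed simp
  have "((\<lambda>t. \<Sum>I\<in>multi_indices m. f I t) has_integral
      (\<Sum>I\<in>multi_indices m. Min (q ` set I) * prod_list (map y I))) {0..T}"
    by (rule has_integral_sum) (auto simp: layer)
  then show ?thesis
    by (rule has_integral_nonneg) (simp add: level m zero_le_even_power)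
qed

section \<open>A sufficient condition for one symmetric tensor\<close>

text \<open>
  Symmetry of \<open>A\<close> cannot be dropped here: a bound in terms of the row sum of one component of a
  multi-index has to be available for every other component as well, which is what makes the
  minimum tensor a majorant.
\<close>

lemma pos_def_if_entries_le_row_sum_prod:
  fixes A :: "'n::finite tensor" and s :: "'n \<Rightarrow> real" and x :: "'n \<Rightarrow> real"
  assumes sym: "symmetric_tensor m A" and m: "even m" "m > 0"
    and row: "\<And>i. tensor_row_sum m A i > 0"
    and s: "\<And>i. s i > 0" "(\<Sum>i\<in>UNIV. s i) < 1"
    and bound: "\<And>i J. length J = m - 1 \<Longrightarrow> J \<noteq> replicate (m - 1) i \<Longrightarrow>
      A (i # J) \<le> tensor_row_sum m A i * prod_list (map s J)"
    and x: "x j \<noteq> 0"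
  shows "(\<Sum>I\<in>multi_indices m. A I * prod_list (map x I)) > 0"
proof -
  obtain m' where m': "m = Suc m'" "m' > 0"
    using m by (cases m; cases "m - 1") auto
  define q where "q i = tensor_row_sum m A i / s i" for i
  have q: "q i > 0" and qs: "q i * s i = tensor_row_sum m A i" for i
    using row[of i] s(1)[of i] by (simp_all add: q_def)
  define B :: "'n tensor" where "B I = Min (q ` set I) * prod_list (map s I)" for I
  have prod_s: "prod_list (map s I) > 0" for I
    by (induction I) (simp_all add: s(1))
  have symD: "symmetric_tensor m (\<lambda>I. A I - B I)"
    unfolding symmetric_tensor_iff_mset
  proof (intro ballI impI)
    fix I J :: "'n list"
    assume "I \<in> multi_indices m" and IJ: "mset I = mset J"
    then have "A I = A J" using symmetric_tensorD[OF sym] by (auto simp: multi_indices_def)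
    moreover have "B I = B J"
      unfolding B_def using IJ by (metis mset_eq_setD prod_list_map_mset_cong)
    ultimately show "A I - B I = A J - B J" by simp
  qed
  have off: "A I - B I \<le> 0" if I: "length I = m" and nc: "\<And>i. I \<noteq> replicate m i" for I
  proof -
    have "I \<noteq> []" using I m by auto
    then have "Min (q ` set I) \<in> q ` set I" by (intro Min_in) auto
    \<comment> \<open>The component attaining the minimum is the one moved to the front.\<close>
    then obtain i where i: "i \<in> set I" "Min (q ` set I) = q i" by auto
    define J where "J = remove1 i I"
    have ms: "mset I = mset (i # J)" using i(1) by (simp add: J_def)
    have lJ: "length J = m - 1" using i(1) I by (simp add: J_def length_remove1)
    have "J \<noteq> replicate (m - 1) i"
    proof
      assume "J = replicate (m - 1) i"
      then have "mset I = mset (replicate m i)" using ms m' by simp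
      then have "set I \<subseteq> {i}" using mset_eq_setD by fastforce
      then have "I = replicate m i"
        using I by (metis replicate_length_same singletonD subset_iff)
      then show False using nc by blast
    qed
    then have "A (i # J) \<le> tensor_row_sum m A i * prod_list (map s J)"
      using bound lJ by blast
    also have "\<dots> = B I"
      using i(2) prod_list_map_mset_cong[OF ms, of s] by (simp add: B_def flip: qs)
    finally show ?thesis using symmetric_tensorD[OF sym I ms] by simp
  qed
  have rowD: "tensor_row_sum m (\<lambda>I. A I - B I) i > 0" for i
  proof -
    have "tensor_row_sum m B i \<le> (\<Sum>J\<in>multi_indices m'. q i * s i * prod_list (map s J))"
      unfolding tensor_row_sum_def m' diff_Suc_1
    proof (rule sum_mono)
      fix J :: "'n list"
      have "Min (q ` set (i # J)) \<le> q i" by (intro Min_le) auto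
      then show "B (i # J) \<le> q i * s i * prod_list (map s J)"
        using mult_right_mono[OF _ less_imp_le[OF prod_s[of "i # J"]]] by (simp add: B_def mult.assoc)
    qed
    also have "\<dots> = tensor_row_sum m A i * (\<Sum>i\<in>UNIV. s i) ^ m'"
      by (simp add: qs sum_multi_indices_prod_list flip: sum_distrib_left)
    also have "\<dots> < tensor_row_sum m A i * 1"
    proof (rule mult_strict_left_mono)
      have "0 \<le> (\<Sum>i\<in>UNIV. s i)" using s(1) by (intro sum_nonneg) (simp add: less_imp_le)
      then show "(\<Sum>i\<in>UNIV. s i) ^ m' < 1" using s(2) m'(2) by (simp add: power_less_one_iff)
    qed (rule row)
    finally show ?thesis by (simp add: tensor_row_sum_def sum_subtractf)
  qed
  have "0 < (\<Sum>I\<in>multi_indices m. (A I - B I) * prod_list (map x I))"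
    using Z_tensor_pos_def[of m "\<lambda>I. A I - B I" x j] symD m off rowD x by blast
  moreover have "0 \<le> (\<Sum>I\<in>multi_indices m. B I * prod_list (map x I))"
  proof -
    have "prod_list (map s I) * prod_list (map x I) = prod_list (map (\<lambda>i. s i * x i) I)" for I
      by (induction I) (simp_all add: mult_ac)
    then show ?thesis
      using min_tensor_psd[OF m, of q "\<lambda>i. s i * x i"] q
      by (simp add: B_def mult.assoc less_imp_le)
  qed
  ultimately show ?thesis
    by (simp add: left_diff_distrib sum_subtractf)
qed

section \<open>Bounding the entries of the interval\<close>

text \<open>
  Let \<open>c\<close> be the sum of the entries of row \<open>i\<close> of \<open>L\<close> other than the one at \<open>J\<close>. For \<open>c < 0\<close> the
  quotient \<open>a / (a + c)\<close> decreases in \<open>a\<close>, so \<open>Mbar_entry\<close> need not bound the quotients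
  \<open>a\<^bsub>iJ\<^esub> / R\<^sub>i(A)\<close> in general. It does so for positive \<open>a\<^bsub>iJ\<^esub>\<close> if it is less than \<open>1\<close>, because this
  forces \<open>c > 0\<close>.
\<close>

lemma entry_le_row_sum_Mbar_entry:
  fixes A L U :: "'n::finite tensor"
  assumes m: "m > 0" and LA: "tensor_le m L A" and AU: "tensor_le m A U"
    and row: "tensor_row_sum m L i > 0"
    and J: "J \<in> multi_indices (m - 1)" and M: "Mbar_entry m L U i J < 1"
  shows "A (i # J) \<le> tensor_row_sum m A i * max 0 (Mbar_entry m L U i J)"
proof -
  define c where "c = (\<Sum>K\<in>multi_indices (m - 1) - {J}. L (i # K))"
  define a u where "a = A (i # J)" and "u = U (i # J)"
  have mi: "i # K \<in> multi_indices m" if "K \<in> multi_indices (m - 1)" for K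
    using that m by (simp add: multi_indices_def)
  have split: "tensor_row_sum m X i = X (i # J) + (\<Sum>K\<in>multi_indices (m - 1) - {J}. X (i # K))"
    for X
    unfolding tensor_row_sum_def by (rule sum.remove[OF finite_multi_indices J])
  have Ra: "a + c \<le> tensor_row_sum m A i"
  proof -
    have "c \<le> (\<Sum>K\<in>multi_indices (m - 1) - {J}. A (i # K))"
      unfolding c_def using LA mi by (intro sum_mono) (auto simp: tensor_le_def)
    then show ?thesis
      by (simp add: split a_def)
  qed
  have La: "tensor_row_sum m L i \<le> a + c"
    using LA mi[OF J] by (simp add: split c_def a_def tensor_le_def)
  have au: "a \<le> u" using AU mi[OF J] by (simp add: tensor_le_def a_def u_def)
  have pos: "a + c > 0" "tensor_row_sum m A i > 0" using La Ra row by linarith+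
  show ?thesis
  proof (cases "a \<le> 0")
    case True
    moreover have "0 \<le> tensor_row_sum m A i * max 0 (Mbar_entry m L U i J)"
      using pos by simp
    ultimately show ?thesis by (simp add: a_def)
  next
    case False
    have Mu: "u / (u + c) \<le> Mbar_entry m L U i J"
      by (simp add: Mbar_entry_def u_def c_def)
    have uc: "u + c > 0" using pos au by linarith
    have "u / (u + c) < 1" using Mu M by linarith
    then have c: "c > 0" using uc by (simp add: field_simps)
    have "a = (a + c) * (a / (a + c))" using pos by simp
    also have "a / (a + c) \<le> u / (u + c)"
      using pos uc c au by (simp add: field_simps)
    also have "\<dots> \<le> max 0 (Mbar_entry m L U i J)" using Mu by simp
    finally have "a \<le> (a + c) * max 0 (Mbar_entry m L U i J)"
      using pos by simp
    also have "\<dots> \<le> tensor_row_sum m A i * max 0 (Mbar_entry m L U i J)"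
      using Ra by (intro mult_right_mono) auto
    finally show ?thesis by (simp add: a_def)
  qed
qed

lemma tensor_row_sum_mono:
  fixes A L :: "'n::finite tensor"
  assumes "m > 0" and "tensor_le m L A"
  shows "tensor_row_sum m L i \<le> tensor_row_sum m A i"
  unfolding tensor_row_sum_def using assms
  by (intro sum_mono) (auto simp: tensor_le_def multi_indices_def)

lemma entry_le_row_sum_Mbar:
  fixes A L U :: "'n::finite tensor"
  assumes m: "m > 0" and LA: "tensor_le m L A" and AU: "tensor_le m A U"
    and row: "tensor_row_sum m L i > 0"
    and J: "J \<in> multi_indices (m - 1)" and M: "Mbar m L U J < 1"
    and ne: "J \<noteq> replicate (m - 1) i"
  shows "A (i # J) \<le> tensor_row_sum m A i * max 0 (Mbar m L U J)"
proof -
  have le: "Mbar_entry m L U i J \<le> Mbar m L U J"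
    unfolding Mbar_def using ne by (intro Max_ge) auto
  have "tensor_row_sum m A i * max 0 (Mbar_entry m L U i J)
      \<le> tensor_row_sum m A i * max 0 (Mbar m L U J)"
    using le row tensor_row_sum_mono[OF m LA, of i] by (intro mult_left_mono) auto
  then show ?thesis
    using entry_le_row_sum_Mbar_entry[OF m LA AU row J] le M by linarith
qed

text \<open>The summand of \<open>Sbar\<close> that belongs to the index \<open>i\<close>.\<close>

definition Sbar_summand :: "nat \<Rightarrow> 'n::finite tensor \<Rightarrow> 'n tensor \<Rightarrow> 'n \<Rightarrow> real" where
  "Sbar_summand m L U i =
     max 0 (Max {Mbar m L U J | J. J \<in> multi_indices (m - 1) \<and> i \<in> set J}) powr (1 / (real m - 1))"

lemma Mbar_le_Sbar_summand_power:
  fixes L U :: "'n::finite tensor"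
  assumes m: "m \<ge> 2" and J: "J \<in> multi_indices (m - 1)" and i: "i \<in> set J"
  shows "max 0 (Mbar m L U J) \<le> Sbar_summand m L U i ^ (m - 1)"
proof -
  let ?X = "max 0 (Max {Mbar m L U J | J. J \<in> multi_indices (m - 1) \<and> i \<in> set J})"
  have "Sbar_summand m L U i ^ (m - 1) = ?X"
    using m by (simp add: Sbar_summand_def powr_powr flip: powr_realpow')
  moreover have "Mbar m L U J \<le> Max {Mbar m L U J | J. J \<in> multi_indices (m - 1) \<and> i \<in> set J}"
    using J i by (intro Max_ge) auto
  ultimately show ?thesis by auto
qed

text \<open>
  Each of the \<open>m - 1\<close> factors on the right-hand side is at least the \<open>(m - 1)\<close>-th root of the
  left-hand side.
\<close>

lemma Mbar_le_prod_summands: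
  fixes L U :: "'n::finite tensor"
  assumes m: "m \<ge> 2" and J: "J \<in> multi_indices (m - 1)"
    and s: "\<And>i. Sbar_summand m L U i \<le> s i"
  shows "max 0 (Mbar m L U J) \<le> prod_list (map s J)"
proof -
  define r where "r = max 0 (Mbar m L U J) powr (1 / (real m - 1))"
  have r: "r ^ (m - 1) = max 0 (Mbar m L U J)"
    using m by (simp add: r_def powr_powr flip: powr_realpow')
  have "r \<le> s i" if "i \<in> set J" for i
  proof -
    have "r ^ (m - 1) \<le> Sbar_summand m L U i ^ (m - 1)"
      using Mbar_le_Sbar_summand_power[OF m J that] r by simp
    then have "r \<le> Sbar_summand m L U i"
      using m by (subst (asm) power_mono_iff) (auto simp: r_def Sbar_summand_def)
    then show ?thesis using s[of i] by simp
  qed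
  moreover have "r \<ge> 0" by (simp add: r_def)
  ultimately have "r ^ length K \<le> prod_list (map s K)" if "set K \<subseteq> set J" for K
    using that by (induction K) (auto intro!: mult_mono intro: order_trans)
  from this[of J] have "r ^ (m - 1) \<le> prod_list (map s J)"
    using J by (simp add: multi_indices_def)
  then show ?thesis by (simp only: r)
qed

section \<open>Positive definiteness of the interval tensor\<close>

theorem corollary4p5:
  fixes m :: nat and L U :: "'n::finite tensor"
  assumes "m \<ge> 2" and "even m" and "CARD('n) \<ge> 2"
    and "tensor_le m L U"
    and "symmetric_interval_tensor m L U"
    and "\<And>i. tensor_row_sum m L i > 0"
    and "Sbar m L U < 1"
  shows "positive_definite_interval_tensor m L U"
  unfolding positive_definite_interval_tensor_def positive_definite_tensor_def
proof (intro ballI allI impI)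
  fix A0 :: "'n tensor" and x :: "real ^ 'n"
  assume A0: "A0 \<in> interval_tensor m L U" and "x \<noteq> 0"
  then obtain j where j: "x $ j \<noteq> 0" by (auto simp: vec_eq_iff)
  have m: "m > 0" using assms(1) by simp
  let ?x = "\<lambda>I. prod_list (map (\<lambda>i. x $ i) I)"
  \<comment> \<open>The member of the interval whose form is smallest at \<open>x\<close>.\<close>
  define A where "A I = (if ?x I \<ge> 0 then L I else U I)" for I
  have LA: "tensor_le m L A" and AU: "tensor_le m A U"
    using assms(4) by (auto simp: A_def tensor_le_def)
  have rowA: "tensor_row_sum m A i > 0" for i
    using tensor_row_sum_mono[OF m LA, of i] assms(6)[of i] by linarith
  have symA: "symmetric_tensor m A"
    unfolding symmetric_tensor_iff_mset
  proof (intro ballI impI)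
    fix I J :: "'n list"
    assume I: "I \<in> multi_indices m" and IJ: "mset I = mset J"
    show "A I = A J"
      using symmetric_interval_tensorD[OF assms(5)] I IJ prod_list_map_mset_cong[OF IJ]
      by (auto simp: A_def multi_indices_def dest: symmetric_tensorD)
  qed
  \<comment> \<open>The summands of \<open>Sbar\<close> may vanish; adding \<open>e\<close> makes them positive while using up only half of
    the gap between \<open>Sbar\<close> and \<open>1\<close>.\<close>
  define e where "e = (1 - Sbar m L U) / (2 * real CARD('n))"
  define s where "s i = Sbar_summand m L U i + e" for i
  have e: "e > 0" using assms(7) by (simp add: e_def)
  have nonneg: "Sbar_summand m L U i \<ge> 0" for i by (simp add: Sbar_summand_def)
  have Sbar: "Sbar m L U = (\<Sum>i\<in>UNIV. Sbar_summand m L U i)"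
    by (simp add: Sbar_def Sbar_summand_def)
  have s_pos: "s i > 0" for i using e nonneg[of i] by (simp add: s_def)
  have "(\<Sum>i\<in>UNIV. s i) = Sbar m L U + (1 - Sbar m L U) / 2"
    by (simp add: s_def sum.distrib Sbar e_def)
  then have s_sum: "(\<Sum>i\<in>UNIV. s i) < 1" using assms(7) by (simp add: field_simps)
  have bound: "A (i # J) \<le> tensor_row_sum m A i * prod_list (map s J)"
    if J: "length J = m - 1" and ne: "J \<noteq> replicate (m - 1) i" for i J
  proof -
    have J': "J \<in> multi_indices (m - 1)" using J by (simp add: multi_indices_def)
    have "J \<noteq> []" using J assms(1) by auto
    then obtain k where k: "k \<in> set J" by (cases J) auto
    have "Sbar_summand m L U k \<le> Sbar m L U"
      unfolding Sbar by (rule member_le_sum) (auto simp: nonneg)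
    then have "Sbar_summand m L U k ^ (m - 1) < 1"
      using nonneg[of k] assms(1,7) by (simp add: power_less_one_iff)
    then have "Mbar m L U J < 1"
      using Mbar_le_Sbar_summand_power[OF assms(1) J' k, of L U] by simp
    then have "A (i # J) \<le> tensor_row_sum m A i * max 0 (Mbar m L U J)"
      by (rule entry_le_row_sum_Mbar[OF m LA AU assms(6) J' _ ne])
    also have "\<dots> \<le> tensor_row_sum m A i * prod_list (map s J)"
    proof (rule mult_left_mono)
      show "max 0 (Mbar m L U J) \<le> prod_list (map s J)"
        by (rule Mbar_le_prod_summands[OF assms(1) J']) (use e in \<open>simp add: s_def\<close>)
      show "0 \<le> tensor_row_sum m A i" using rowA[of i] by simp
    qed
    finally show ?thesis .
  qed
  have "0 < (\<Sum>I\<in>multi_indices m. A I * ?x I)"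
    using pos_def_if_entries_le_row_sum_prod[of m A s "\<lambda>i. x $ i" j]
      symA assms(2) m rowA s_pos s_sum bound j by blast
  also have "\<dots> \<le> tensor_form m A0 x"
    unfolding tensor_form_def
  proof (rule sum_mono)
    fix I :: "'n list" assume "I \<in> multi_indices m"
    then have "L I \<le> A0 I" "A0 I \<le> U I"
      using A0 by (auto simp: interval_tensor_def tensor_le_def)
    then show "A I * ?x I \<le> A0 I * ?x I"
      by (auto simp: A_def intro: mult_right_mono mult_right_mono_neg)
  qed
  finally show "tensor_form m A0 x > 0" .
qed

end
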